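(* Let $K\ge2$, $T\ge1$, $v\in(0,1]$, $u>0$ and $\beta\in(0,1)$. For every $\epsilon>0$, the DP Robust Successive Elimination algorithm (defined in the context), run for $T$ rounds with confidence $\beta$ and parameters $\epsilon,v,u$, is $\epsilon$-differentially private.
   Context: Bandit interaction and privacy. There are $K$ arms. In each round $t=1,\dots,T$ the algorithm pulls an arm $a_t\in[K]$ and observes a real reward. For a reward stream $\sigma=(\sigma(1),\dots,\sigma(T))\in\mathbb R^T$, running the algorithm on $\sigma$ means that the reward observed in round $t$ is $\sigma(t)$. The output $\mathcal M(\sigma)$ is the random sequence of pulled arms. Two streams are adjacent if they differ at exactly one time step. The algorithm is $\epsilon$-differentially private if for all adjacent $\sigma,\sigma'$ and all measurable $O$, $\mathbb P[\mathcal M(\sigma)\in O]\le e^\epsilon\,\mathbb P[\mathcal M(\sigma')\in O]$. $\mathrm{Lap}(\lambda)$ is the Laplace distribution with density $\frac1{2\lambda}e^{-|x|/\lambda}$. $\log$ is the natural logarithm. DP Robust Successive Elimination (inputs $\beta,\epsilon,v,u$, horizon $T$). Start with the viable set $\mathcal S=[K]$. For epochs $\tau=1,2,\dots$, until $|\mathcal S|=1$ (the procedure is stopped in any case after $T$ pulls): - Set $L_\tau=\log(4|\mathcal S|\tau^2/\beta)$, $D_\tau=2^{-\tau}$, $R_\tau=\left\lceil u^{1/v}\frac{24^{(1+v)/v}L_\tau}{\epsilon D_\tau^{(1+v)/v}}+1\right\rceil$ and $B_\tau=\left(\frac{uR_\tau\epsilon}{L_\tau}\right)^{1/(1+v)}$.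 - Pull each $a\in\mathcal S$ exactly $R_\tau$ times (cycling through $\mathcal S$), getting fresh rewards $x_{a,1},\dots,x_{a,R_\tau}$. Truncate them as $\widetilde x_{a,r}=x_{a,r}\mathbb I_{\{|x_{a,r}|\le B_\tau\}}$. - Set $\bar\mu_a=\frac1{R_\tau}\sum_{r=1}^{R_\tau}\widetilde x_{a,r}$ and $\widetilde\mu_a=\bar\mu_a+\mathrm{Lap}\left(\frac{2B_\tau}{R_\tau\epsilon}\right)$, with independent noises. - Set $err_\tau=u^{1/(1+v)}\left(\frac{L_\tau}{R_\tau\epsilon}\right)^{v/(1+v)}$ and remove from $\mathcal S$ every arm $a$ with $\max_{a'\in\mathcal S}\widetilde\mu_{a'}-\widetilde\mu_a>12\,err_\tau$. Once $|\mathcal S|=1$, pull the remaining arm in all remaining rounds. *)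

theory Defs
  imports "HOL-Probability.Probability"
begin

section \<open>Differential privacy for mechanisms on real streams\<close>

definition adjacent :: "real list \<Rightarrow> real list \<Rightarrow> bool" where
  "adjacent \<sigma> \<sigma>' \<longleftrightarrow>
     length \<sigma> = length \<sigma>' \<and> (\<exists>!t. t < length \<sigma> \<and> \<sigma> ! t \<noteq> \<sigma>' ! t)"

text \<open>A mechanism maps a stream in \<open>\<real>\<^sup>T\<close>, given as a list of length \<open>T\<close>, to the distribution
  of its output.\<close>

definition differentially_private ::
    "nat \<Rightarrow> real \<Rightarrow> (real list \<Rightarrow> 'b measure) \<Rightarrow> bool" where
  "differentially_private T \<epsilon> M \<longleftrightarrow>
     (\<forall>\<sigma> \<sigma>'. length \<sigma> = T \<and> length \<sigma>' = T \<and> adjacent \<sigma> \<sigma>' \<longrightarrow>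
        (\<forall>A\<in>sets (M \<sigma>). measure (M \<sigma>) A \<le> exp \<epsilon> * measure (M \<sigma>') A))"

definition laplace_density :: "real \<Rightarrow> real \<Rightarrow> real" where
  "laplace_density b x = 1 / (2 * b) * exp (- \<bar>x\<bar> / b)"

definition Lap :: "real \<Rightarrow> real measure" where
  "Lap b = density lborel (\<lambda>x. ennreal (laplace_density b x))"


section \<open>DP Robust Successive Elimination\<close>

text \<open>Arms are natural numbers, \<open>S\<close> is the viable set and \<open>\<tau>\<close> the current epoch.\<close>

context
  fixes \<beta> \<epsilon> v u :: real
begin

definition epoch_L :: "nat set \<Rightarrow> nat \<Rightarrow> real" where
  "epoch_L S \<tau> = ln (4 * real (card S) * (real \<tau>)\<^sup>2 / \<beta>)"

definition epoch_D :: "nat \<Rightarrow> real" where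
  "epoch_D \<tau> = 2 powi (- int \<tau>)"

definition epoch_R :: "nat set \<Rightarrow> nat \<Rightarrow> nat" where
  "epoch_R S \<tau> = nat \<lceil>u powr (1 / v) *
      (24 powr ((1 + v) / v) * epoch_L S \<tau> / (\<epsilon> * epoch_D \<tau> powr ((1 + v) / v))) + 1\<rceil>"

definition epoch_B :: "nat set \<Rightarrow> nat \<Rightarrow> real" where
  "epoch_B S \<tau> = (u * real (epoch_R S \<tau>) * \<epsilon> / epoch_L S \<tau>) powr (1 / (1 + v))"

definition epoch_err :: "nat set \<Rightarrow> nat \<Rightarrow> real" where
  "epoch_err S \<tau> =
     u powr (1 / (1 + v)) * (epoch_L S \<tau> / (real (epoch_R S \<tau>) * \<epsilon>)) powr (v / (1 + v))"

text \<open>A history \<open>h\<close> is the list of pairs (arm pulled, reward observed) of the current epoch, in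
  chronological order.\<close>

definition rewards :: "nat \<Rightarrow> (nat \<times> real) list \<Rightarrow> real list" where
  "rewards a h = map snd (filter (\<lambda>(a', x). a' = a) h)"

definition truncated_mean :: "nat set \<Rightarrow> nat \<Rightarrow> (nat \<times> real) list \<Rightarrow> nat \<Rightarrow> real" where
  "truncated_mean S \<tau> h a =
     (\<Sum>x\<leftarrow>rewards a h. if \<bar>x\<bar> \<le> epoch_B S \<tau> then x else 0) / real (epoch_R S \<tau>)"

definition noise :: "nat set \<Rightarrow> nat \<Rightarrow> (nat \<Rightarrow> real) measure" where
  "noise S \<tau> = (\<Pi>\<^sub>M a\<in>S. Lap (2 * epoch_B S \<tau> / (real (epoch_R S \<tau>) * \<epsilon>)))"

definition noisy_mean ::
    "nat set \<Rightarrow> nat \<Rightarrow> (nat \<times> real) list \<Rightarrow> (nat \<Rightarrow> real) \<Rightarrow> nat \<Rightarrow> real" where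
  "noisy_mean S \<tau> h \<eta> a = truncated_mean S \<tau> h a + \<eta> a"

definition survivors ::
    "nat set \<Rightarrow> nat \<Rightarrow> (nat \<times> real) list \<Rightarrow> (nat \<Rightarrow> real) \<Rightarrow> nat set" where
  "survivors S \<tau> h \<eta> =
     S - {a \<in> S. Max (noisy_mean S \<tau> h \<eta> ` S) - noisy_mean S \<tau> h \<eta> a > 12 * epoch_err S \<tau>}"

definition next_arm :: "nat set \<Rightarrow> (nat \<times> real) list \<Rightarrow> nat" where
  "next_arm S h = sorted_list_of_set S ! (length h mod card S)"

text \<open>\<open>run S \<tau> h xs\<close> is the distribution of the arms pulled in the remaining rounds, whose rewards
  are \<open>xs\<close>. The epoch has \<open>card S * epoch_R S \<tau>\<close> rounds; when the last one has been played,
  fresh noise is drawn and arms are eliminated. An epoch cut short by the horizon draws no noise.\<close>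

primrec run ::
    "nat set \<Rightarrow> nat \<Rightarrow> (nat \<times> real) list \<Rightarrow> real list \<Rightarrow> nat list measure" where
  "run S \<tau> h [] = return (count_space UNIV) []"
| "run S \<tau> h (x # xs) =
     (let a = next_arm S h; h' = h @ [(a, x)] in
        distr
          (if card S = 1 then run S \<tau> h xs
           else if length h' < card S * epoch_R S \<tau> then run S \<tau> h' xs
           else noise S \<tau> \<bind> (\<lambda>\<eta>. run (survivors S \<tau> h' \<eta>) (\<tau> + 1) [] xs))
          (count_space UNIV) (Cons a))"

definition dp_rse :: "nat \<Rightarrow> real list \<Rightarrow> nat list measure" where
  "dp_rse K \<sigma> = run {1..K} 1 [] \<sigma>"

end


section \<open>The output distribution is well-defined\<close>

lemma sets_Lap [measurable_cong, simp]: "sets (Lap b) = sets borel"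
  by (simp add: Lap_def)

lemma space_Lap [simp]: "space (Lap b) = UNIV"
  by (simp add: Lap_def)

lemma prob_space_Lap:
  assumes "b > 0"
  shows "prob_space (Lap b)"
proof
  let ?e = "\<lambda>x. ennreal (exponential_density (1 / b) x)"
  have e1: "(\<integral>\<^sup>+x. ?e x \<partial>lborel) = 1"
    using prob_space.emeasure_space_1[OF prob_space_exponential_density[of "1 / b"]] assms
    by (simp add: emeasure_density)
  have e2: "(\<integral>\<^sup>+x. ?e (- x) \<partial>lborel) = 1"
    using nn_integral_real_affine[of ?e "-1" 0] e1 by simp
  have "emeasure (Lap b) (space (Lap b)) = (\<integral>\<^sup>+x. ennreal (laplace_density b x) \<partial>lborel)"
    unfolding Lap_def laplace_density_def by (subst emeasure_density) auto
  also have "\<dots> = (\<integral>\<^sup>+x. ennreal (1 / 2) * ?e x + ennreal (1 / 2) * ?e (- x) \<partial>lborel)"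
  proof (rule nn_integral_cong_AE, rule eventually_mono[OF AE_lborel_singleton[of "0::real"]])
    fix x :: real assume "x \<noteq> 0"
    then have "laplace_density b x =
        1 / 2 * exponential_density (1 / b) x + 1 / 2 * exponential_density (1 / b) (- x)"
      by (auto simp: laplace_density_def exponential_density_def)
    then show "ennreal (laplace_density b x) = ennreal (1 / 2) * ?e x + ennreal (1 / 2) * ?e (- x)"
      using assms by (simp only: ennreal_plus ennreal_mult'' erlang_density_nonneg
        mult_nonneg_nonneg zero_less_divide_1_iff less_imp_le zero_le_divide_1_iff)
  qed
  also have "\<dots> = ennreal (1 / 2) * 1 + ennreal (1 / 2) * 1"
    by (subst nn_integral_add, simp, simp, subst (1 2) nn_integral_cmult) (simp_all add: e1 e2)
  also have "\<dots> = 1"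
    by (simp only: mult_1_right ennreal_plus[symmetric] zero_le_divide_1_iff) simp
  finally show "emeasure (Lap b) (space (Lap b)) = 1" .
qed

lemma epoch_L_pos:
  assumes "0 < \<beta>" "\<beta> < 1" "finite S" "S \<noteq> {}" "\<tau> \<ge> 1"
  shows "epoch_L \<beta> S \<tau> > 0"
proof -
  have "1 \<le> real (card S)" "1 \<le> (real \<tau>)\<^sup>2"
    using assms by (auto simp: Suc_le_eq card_gt_0_iff)
  then have "1 * 1 \<le> real (card S) * (real \<tau>)\<^sup>2"
    by (intro mult_mono) auto
  then have "1 < 4 * real (card S) * (real \<tau>)\<^sup>2 / \<beta>"
    using assms by (simp add: field_simps)
  then show ?thesis
    by (simp add: epoch_L_def)
qed

lemma epoch_R_pos:
  assumes "0 < \<beta>" "\<beta> < 1" "\<epsilon> > 0" "finite S" "S \<noteq> {}" "\<tau> \<ge> 1"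
  shows "epoch_R \<beta> \<epsilon> v u S \<tau> > 0"
proof -
  have "u powr (1 / v) *
      (24 powr ((1 + v) / v) * epoch_L \<beta> S \<tau> / (\<epsilon> * epoch_D \<tau> powr ((1 + v) / v))) \<ge> 0"
    using epoch_L_pos[OF assms(1,2,4-6)] assms(3)
    by (intro mult_nonneg_nonneg divide_nonneg_nonneg) auto
  then show ?thesis
    unfolding epoch_R_def by linarith
qed

lemma noise_scale_pos:
  assumes "0 < \<beta>" "\<beta> < 1" "\<epsilon> > 0" "u > 0" "finite S" "S \<noteq> {}" "\<tau> \<ge> 1"
  shows "2 * epoch_B \<beta> \<epsilon> v u S \<tau> / (real (epoch_R \<beta> \<epsilon> v u S \<tau>) * \<epsilon>) > 0"
  using epoch_L_pos[OF assms(1,2,5-7)] epoch_R_pos[OF assms(1-3,5-7), of v u] assms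
  by (simp add: epoch_B_def)

lemma survivors_subset: "survivors \<beta> \<epsilon> v u S \<tau> h \<eta> \<subseteq> S"
  by (auto simp: survivors_def)

lemma survivors_nonempty:
  assumes "finite S" "S \<noteq> {}"
  shows "survivors \<beta> \<epsilon> v u S \<tau> h \<eta> \<noteq> {}"
proof -
  let ?f = "noisy_mean \<beta> \<epsilon> v u S \<tau> h \<eta>"
  have "Max (?f ` S) \<in> ?f ` S"
    using assms by (intro Max_in) auto
  then obtain a where "a \<in> S" "Max (?f ` S) = ?f a"
    by auto
  then have "a \<in> survivors \<beta> \<epsilon> v u S \<tau> h \<eta>"
    by (auto simp: survivors_def epoch_err_def not_less)
  then show ?thesis by auto
qed

lemma measurable_survivors:
  assumes "finite S"
  shows "survivors \<beta> \<epsilon> v u S \<tau> h \<in> noise \<beta> \<epsilon> v u S \<tau> \<rightarrow>\<^sub>M count_space (Pow S)"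
proof -
  let ?N = "noise \<beta> \<epsilon> v u S \<tau>"
  have c: "(\<lambda>\<eta>. \<eta> a) \<in> borel_measurable ?N" if "a \<in> S" for a
    using measurable_component_singleton[OF that, of "\<lambda>_. Lap _"]
    unfolding noise_def by (simp cong: measurable_cong_sets)
  then have m: "(\<lambda>\<eta>. noisy_mean \<beta> \<epsilon> v u S \<tau> h \<eta> a) \<in> borel_measurable ?N" if "a \<in> S" for a
    unfolding noisy_mean_def using that by (intro borel_measurable_add) auto
  have "(\<lambda>\<eta>. Max ((\<lambda>a. noisy_mean \<beta> \<epsilon> v u S \<tau> h \<eta> a) ` S)) \<in> borel_measurable ?N"
    using assms m by (rule borel_measurable_Max)
  then have p: "{\<eta> \<in> space ?N. Max ((\<lambda>a. noisy_mean \<beta> \<epsilon> v u S \<tau> h \<eta> a) ` S)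
      - noisy_mean \<beta> \<epsilon> v u S \<tau> h \<eta> a > 12 * epoch_err \<beta> \<epsilon> v u S \<tau>} \<in> sets ?N"
    if "a \<in> S" for a
    using m[OF that] by measurable
  have "survivors \<beta> \<epsilon> v u S \<tau> h -` {S'} \<inter> space ?N =
      {\<eta> \<in> space ?N. \<forall>a\<in>S. (a \<notin> S') \<longleftrightarrow> Max ((\<lambda>a. noisy_mean \<beta> \<epsilon> v u S \<tau> h \<eta> a) ` S)
        - noisy_mean \<beta> \<epsilon> v u S \<tau> h \<eta> a > 12 * epoch_err \<beta> \<epsilon> v u S \<tau>}" if "S' \<subseteq> S" for S'
    using that by (auto simp: survivors_def)
  moreover have "\<dots> S' \<in> sets ?N" for S'
    using assms p by (intro sets.sets_Collect_finite_All sets.sets_Collect) auto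
  ultimately show ?thesis
    using assms survivors_subset by (subst measurable_count_space_eq2) auto
qed

lemma run_in_prob_algebra:
  assumes "0 < \<beta>" "\<beta> < 1" "\<epsilon> > 0" "u > 0" "finite S" "S \<noteq> {}" "\<tau> \<ge> 1"
  shows "run \<beta> \<epsilon> v u S \<tau> h xs \<in> space (prob_algebra (count_space UNIV))"
  using assms(5-)
proof (induction xs arbitrary: S \<tau> h)
  case Nil
  then show ?case
    by (simp add: space_prob_algebra prob_space_return)
next
  case (Cons x xs)
  let ?C = "count_space (UNIV :: nat list set)"
  have distr: "distr M ?C (Cons a) \<in> space (prob_algebra ?C)"
    if "M \<in> space (prob_algebra ?C)" for M :: "nat list measure" and a
    using that by (auto simp: space_prob_algebra measurable_def sets_eq_imp_space_eq[of M ?C]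
      intro!: prob_space.prob_space_distr)
  have "noise \<beta> \<epsilon> v u S \<tau> \<bind> (\<lambda>\<eta>. run \<beta> \<epsilon> v u (survivors \<beta> \<epsilon> v u S \<tau> h' \<eta>) (\<tau> + 1) [] xs)
      \<in> space (prob_algebra ?C)" for h'
  proof -
    let ?N = "noise \<beta> \<epsilon> v u S \<tau>" and ?P = "Pow S - {{}}"
    interpret prob_space ?N
      unfolding noise_def
      by (intro prob_space_PiM prob_space_Lap noise_scale_pos assms Cons.prems)
    have "survivors \<beta> \<epsilon> v u S \<tau> h' \<in> ?N \<rightarrow>\<^sub>M count_space ?P"
      using measurable_survivors[OF Cons.prems(1)] survivors_nonempty[OF Cons.prems(1,2)]
        survivors_subset Cons.prems(1)
      by (fastforce simp: measurable_count_space_eq2)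
    moreover have "(\<lambda>S'. run \<beta> \<epsilon> v u S' (\<tau> + 1) [] xs) \<in> count_space ?P \<rightarrow>\<^sub>M prob_algebra ?C"
      using Cons.prems by (auto intro!: Cons.IH intro: finite_subset)
    ultimately have k: "(\<lambda>\<eta>. run \<beta> \<epsilon> v u (survivors \<beta> \<epsilon> v u S \<tau> h' \<eta>) (\<tau> + 1) [] xs)
        \<in> ?N \<rightarrow>\<^sub>M prob_algebra ?C"
      by (rule measurable_compose)
    show ?thesis
      using k prob_space_bind'[OF _ k, of] sets_bind'[OF _ k]
      by (auto simp: space_prob_algebra prob_space_axioms)
  qed
  then show ?case
    using Cons by (auto simp: Let_def intro!: distr)
qed

lemma prob_space_dp_rse:
  assumes "0 < \<beta>" "\<beta> < 1" "\<epsilon> > 0" "u > 0" "K \<ge> 1"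
  shows "prob_space (dp_rse \<beta> \<epsilon> v u K \<sigma>)" and "sets (dp_rse \<beta> \<epsilon> v u K \<sigma>) = UNIV"
proof -
  have "dp_rse \<beta> \<epsilon> v u K \<sigma> \<in> space (prob_algebra (count_space UNIV))"
    unfolding dp_rse_def using assms by (intro run_in_prob_algebra) auto
  then show "prob_space (dp_rse \<beta> \<epsilon> v u K \<sigma>)" "sets (dp_rse \<beta> \<epsilon> v u K \<sigma>) = UNIV"
    by (auto simp: space_prob_algebra)
qed

end

theory Submission
  imports Defs
begin

text \<open>Until the round where the streams differ, both runs have the same law given the viable set.
  Afterwards the histories differ in one reward of one arm \<open>a\<close>, which is only felt when the current
  epoch ends: replacing it moves the truncated mean of \<open>a\<close> by at most \<open>2 B / R\<close>, the same effect as
  translating one Laplace coordinate of scale \<open>2 B / (R \<epsilon>)\<close>, which costs a factor \<open>exp \<epsilon>\<close>. From then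
  on the history is discarded and the rewards agree, so the rest is post-processing.\<close>

section \<open>Translating Laplace noise\<close>

lemma laplace_density_nonneg: "b > 0 \<Longrightarrow> laplace_density b x \<ge> 0"
  by (simp add: laplace_density_def)

text \<open>The triangle inequality \<bar>x\<bar> \<le> \<bar>x + \<delta>\<bar> +
  \<bar>\<delta>\<bar>, read in the exponent.\<close>

lemma laplace_density_shift_le:
  assumes "b > 0"
  shows "laplace_density b (x + \<delta>) \<le> exp (\<bar>\<delta>\<bar> / b) * laplace_density b x"
proof -
  have "- \<bar>x + \<delta>\<bar> / b \<le> (\<bar>\<delta>\<bar> - \<bar>x\<bar>) / b"
    using assms by (intro divide_right_mono) auto
  then have "exp (- \<bar>x + \<delta>\<bar> / b) \<le> exp (\<bar>\<delta>\<bar> / b) * exp (- \<bar>x\<bar> / b)"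
    by (simp add: exp_add[symmetric] diff_divide_distrib)
  then show ?thesis
    using assms by (simp add: laplace_density_def divide_simps)
qed

lemma borel_measurable_laplace_density [measurable]: "laplace_density b \<in> borel_measurable borel"
  unfolding laplace_density_def[abs_def] by measurable

text \<open>Lebesgue measure is translation invariant, so the shift can be moved onto the density,
  where the pointwise ratio bound applies. Integrands rather than events are treated because
  \<open>f\<close> will be the probability of an output set given the noise.\<close>

lemma nn_integral_Lap_shift_le:
  assumes "b > 0" and [measurable]: "f \<in> borel_measurable borel"
  shows "(\<integral>\<^sup>+x. f x \<partial>Lap b) \<le> ennreal (exp (\<bar>\<delta>\<bar> / b)) * (\<integral>\<^sup>+x. f (x + \<delta>) \<partial>Lap b)"
proof -
  let ?p = "\<lambda>x. ennreal (laplace_density b x)"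
  have "(\<integral>\<^sup>+x. f x \<partial>Lap b) = (\<integral>\<^sup>+x. ?p x * f x \<partial>lborel)"
    unfolding Lap_def by (subst nn_integral_density) auto
  also have "\<dots> = (\<integral>\<^sup>+x. ?p (x + \<delta>) * f (x + \<delta>) \<partial>lborel)"
    using nn_integral_real_affine[of "\<lambda>x. ?p x * f x" 1 \<delta>] by (simp add: add.commute)
  also have "\<dots> \<le> (\<integral>\<^sup>+x. ennreal (exp (\<bar>\<delta>\<bar> / b)) * (?p x * f (x + \<delta>)) \<partial>lborel)"
  proof (rule nn_integral_mono)
    fix x
    have "?p (x + \<delta>) \<le> ennreal (exp (\<bar>\<delta>\<bar> / b)) * ?p x"
      using laplace_density_shift_le[OF assms(1)] laplace_density_nonneg[OF assms(1)]
      by (simp add: ennreal_mult[symmetric] ennreal_leI)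
    then show "?p (x + \<delta>) * f (x + \<delta>) \<le> ennreal (exp (\<bar>\<delta>\<bar> / b)) * (?p x * f (x + \<delta>))"
      by (simp add: mult.assoc[symmetric] mult_right_mono)
  qed
  also have "\<dots> = ennreal (exp (\<bar>\<delta>\<bar> / b)) * (\<integral>\<^sup>+x. ?p x * f (x + \<delta>) \<partial>lborel)"
    by (rule nn_integral_cmult) measurable
  also have "(\<integral>\<^sup>+x. ?p x * f (x + \<delta>) \<partial>lborel) = (\<integral>\<^sup>+x. f (x + \<delta>) \<partial>Lap b)"
    unfolding Lap_def by (subst nn_integral_density) auto
  finally show ?thesis .
qed

text \<open>Only coordinate \<open>a\<close> moves, so by Fubini the one-dimensional bound is
  applied to the inner integral over that coordinate, with the others frozen.\<close>

lemma nn_integral_PiM_Lap_shift_le: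
  assumes "b > 0" "finite S" "a \<in> S"
    and f: "f \<in> borel_measurable (\<Pi>\<^sub>M i\<in>S. Lap b)"
  shows "(\<integral>\<^sup>+\<eta>. f \<eta> \<partial>(\<Pi>\<^sub>M i\<in>S. Lap b)) \<le>
    ennreal (exp (\<bar>\<delta>\<bar> / b)) * (\<integral>\<^sup>+\<eta>. f (\<eta>(a := \<eta> a + \<delta>)) \<partial>(\<Pi>\<^sub>M i\<in>S. Lap b))"
proof -
  interpret Lap: prob_space "Lap b"
    by (rule prob_space_Lap[OF assms(1)])
  interpret product_sigma_finite "\<lambda>_. Lap b"
    by unfold_locales
  let ?I = "S - {a}"
  let ?c = "ennreal (exp (\<bar>\<delta>\<bar> / b))"
  have S: "S = insert a ?I" "finite ?I" "a \<notin> ?I"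
    using assms by auto
  have shift: "(\<lambda>\<eta>. \<eta>(a := \<eta> a + \<delta>)) \<in> (\<Pi>\<^sub>M i\<in>S. Lap b) \<rightarrow>\<^sub>M (\<Pi>\<^sub>M i\<in>S. Lap b)"
  proof (rule measurable_fun_upd[where J = S])
    have "(\<lambda>\<eta>. \<eta> a) \<in> (\<Pi>\<^sub>M i\<in>S. Lap b) \<rightarrow>\<^sub>M Lap b"
      using assms by measurable
    then show "(\<lambda>\<eta>. \<eta> a + \<delta>) \<in> (\<Pi>\<^sub>M i\<in>S. Lap b) \<rightarrow>\<^sub>M Lap b"
      by (simp cong: measurable_cong_sets)
  qed (use assms in auto)
  have slice: "(\<lambda>y. f (x(a := y))) \<in> borel_measurable borel" if "x \<in> space (\<Pi>\<^sub>M i\<in>?I. Lap b)" for x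
  proof -
    have "(\<lambda>y. x(a := y)) \<in> Lap b \<rightarrow>\<^sub>M (\<Pi>\<^sub>M i\<in>S. Lap b)"
      by (rule measurable_fun_upd[where J = ?I]) (use that assms in auto)
    from measurable_compose[OF this f] show ?thesis
      by (simp cong: measurable_cong_sets)
  qed
  have upd: "(\<lambda>(x, y). x(a := y)) \<in> (\<Pi>\<^sub>M i\<in>?I. Lap b) \<Otimes>\<^sub>M Lap b \<rightarrow>\<^sub>M (\<Pi>\<^sub>M i\<in>S. Lap b)"
    using measurable_add_dim[of a ?I "\<lambda>_. Lap b"] S(1) by simp
  have inner: "(\<lambda>x. \<integral>\<^sup>+y. f (x(a := y + \<delta>)) \<partial>Lap b) \<in> borel_measurable (\<Pi>\<^sub>M i\<in>?I. Lap b)"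
    using Lap.borel_measurable_nn_integral[of "\<lambda>x y. f (x(a := y + \<delta>))" "\<Pi>\<^sub>M i\<in>?I. Lap b"]
      measurable_compose[OF upd measurable_compose[OF shift f]]
    by (simp add: case_prod_beta')
  have "(\<integral>\<^sup>+\<eta>. f \<eta> \<partial>(\<Pi>\<^sub>M i\<in>S. Lap b)) =
      (\<integral>\<^sup>+x. (\<integral>\<^sup>+y. f (x(a := y)) \<partial>Lap b) \<partial>(\<Pi>\<^sub>M i\<in>?I. Lap b))"
    using product_nn_integral_insert[of ?I a f] f S by simp
  also have "\<dots> \<le> (\<integral>\<^sup>+x. ?c * (\<integral>\<^sup>+y. f (x(a := y + \<delta>)) \<partial>Lap b) \<partial>(\<Pi>\<^sub>M i\<in>?I. Lap b))"
    by (intro nn_integral_mono nn_integral_Lap_shift_le[OF assms(1) slice])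
  also have "\<dots> = ?c * (\<integral>\<^sup>+x. (\<integral>\<^sup>+y. f (x(a := y + \<delta>)) \<partial>Lap b) \<partial>(\<Pi>\<^sub>M i\<in>?I. Lap b))"
    by (rule nn_integral_cmult[OF inner])
  also have "(\<integral>\<^sup>+x. (\<integral>\<^sup>+y. f (x(a := y + \<delta>)) \<partial>Lap b) \<partial>(\<Pi>\<^sub>M i\<in>?I. Lap b)) =
      (\<integral>\<^sup>+\<eta>. f (\<eta>(a := \<eta> a + \<delta>)) \<partial>(\<Pi>\<^sub>M i\<in>S. Lap b))"
    using product_nn_integral_insert[of ?I a "\<lambda>\<eta>. f (\<eta>(a := \<eta> a + \<delta>))"]
      measurable_compose[OF shift f] S by simp
  finally show ?thesis .
qed


section \<open>Sensitivity of one epoch\<close>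

lemma next_arm_in:
  assumes "finite S" "S \<noteq> {}"
  shows "next_arm S h \<in> S"
proof -
  have "sorted_list_of_set S ! (length h mod card S) \<in> set (sorted_list_of_set S)"
    using assms by (intro nth_mem) (simp add: card_gt_0_iff)
  then show ?thesis
    using assms by (simp add: next_arm_def)
qed

lemma truncated_mean_replace:
  assumes "a' \<noteq> a"
  shows "truncated_mean \<beta> \<epsilon> v u S \<tau> (h1 @ (a, x) # h2) a' =
    truncated_mean \<beta> \<epsilon> v u S \<tau> (h1 @ (a, y) # h2) a'"
  using assms by (simp add: truncated_mean_def rewards_def)

text \<open>Truncation keeps every summand in the interval [-B, B], so exchanging one summand moves
  the sum by at most 2 B.\<close>

lemma truncated_mean_sensitivity:
  "\<bar>truncated_mean \<beta> \<epsilon> v u S \<tau> (h1 @ (a, y) # h2) a - truncated_mean \<beta> \<epsilon> v u S \<tau> (h1 @ (a, x) # h2) a\<bar>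
    \<le> 2 * epoch_B \<beta> \<epsilon> v u S \<tau> / real (epoch_R \<beta> \<epsilon> v u S \<tau>)"
proof -
  let ?B = "epoch_B \<beta> \<epsilon> v u S \<tau>" and ?R = "real (epoch_R \<beta> \<epsilon> v u S \<tau>)"
  let ?trunc = "\<lambda>x. if \<bar>x\<bar> \<le> ?B then x else 0"
  \<comment> \<open>A rejected reward counts as 0, which lies in [-B, B] because B, being a
    \<open>powr\<close>, is nonnegative.\<close>
  have "?B \<ge> 0"
    by (simp add: epoch_B_def)
  then have trunc: "\<bar>?trunc y - ?trunc x\<bar> \<le> 2 * ?B"
    by auto
  have "truncated_mean \<beta> \<epsilon> v u S \<tau> (h1 @ (a, z) # h2) a =
      (sum_list (map ?trunc (rewards a h1)) + sum_list (map ?trunc (rewards a h2))) / ?R + ?trunc z / ?R" for z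
    by (simp only: truncated_mean_def rewards_def add_divide_distrib filter_append filter.simps
        prod.case if_True map_append list.map snd_conv sum_list.append sum_list.Cons ac_simps simp_thms)
  then have "truncated_mean \<beta> \<epsilon> v u S \<tau> (h1 @ (a, y) # h2) a -
      truncated_mean \<beta> \<epsilon> v u S \<tau> (h1 @ (a, x) # h2) a = (?trunc y - ?trunc x) / ?R"
    by (simp only: diff_divide_distrib add_diff_cancel_left)
  then show ?thesis
    using divide_right_mono[OF trunc, of ?R] by (simp only: abs_divide abs_of_nat of_nat_0_le_iff)
qed

text \<open>Elimination sees rewards and noise only through their sum in the noisy means, so a
  changed reward of \<open>a\<close> can be traded, for each fixed noise vector, for a shift of the
  noise of \<open>a\<close>.\<close>

lemma survivors_replace:
  assumes "\<delta> = truncated_mean \<beta> \<epsilon> v u S \<tau> (h1 @ (a, y) # h2) a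
    - truncated_mean \<beta> \<epsilon> v u S \<tau> (h1 @ (a, x) # h2) a"
  shows "survivors \<beta> \<epsilon> v u S \<tau> (h1 @ (a, y) # h2) \<eta> =
    survivors \<beta> \<epsilon> v u S \<tau> (h1 @ (a, x) # h2) (\<eta>(a := \<eta> a + \<delta>))"
proof -
  have "noisy_mean \<beta> \<epsilon> v u S \<tau> (h1 @ (a, y) # h2) \<eta> =
      noisy_mean \<beta> \<epsilon> v u S \<tau> (h1 @ (a, x) # h2) (\<eta>(a := \<eta> a + \<delta>))"
    using assms truncated_mean_replace[of _ a \<beta> \<epsilon> v u S \<tau> h1 x h2 y]
    by (auto simp: noisy_mean_def fun_eq_iff)
  then show ?thesis
    by (simp add: survivors_def)
qed


section \<open>Domination up to a factor\<close>

text \<open>Stated with \<open>emeasure\<close>, so that the bound can be integrated over the noise.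
  All output laws here have every set measurable, hence the quantifier over arbitrary
  \<open>A\<close>.\<close>

definition dominated :: "real \<Rightarrow> 'a measure \<Rightarrow> 'a measure \<Rightarrow> bool" where
  "dominated \<epsilon> M N \<longleftrightarrow> (\<forall>A. emeasure M A \<le> ennreal (exp \<epsilon>) * emeasure N A)"

lemma dominated_refl: "\<epsilon> \<ge> 0 \<Longrightarrow> dominated \<epsilon> M M"
  using mult_right_mono[of 1 "ennreal (exp \<epsilon>)"] by (auto simp: dominated_def)

text \<open>Post-processing: the bound for \<open>A\<close> under the image measures is the bound
  for the preimage of \<open>A\<close>. It is used with \<open>f\<close> prepending the pulled
  arm.\<close>

lemma dominated_distr:
  assumes "dominated \<epsilon> M N" "sets M = UNIV" "sets N = UNIV"
  shows "dominated \<epsilon> (distr M (count_space UNIV) f) (distr N (count_space UNIV) f)"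
proof -
  have m: "f \<in> M \<rightarrow>\<^sub>M count_space UNIV" "f \<in> N \<rightarrow>\<^sub>M count_space UNIV"
    and sp: "space M = UNIV" "space N = UNIV"
    using assms(2,3) sets_eq_imp_space_eq[of _ "count_space UNIV"] by (auto simp: measurable_def)
  show ?thesis
    using assms(1) m sp by (simp add: dominated_def emeasure_distr)
qed

lemma dominated_imp_measure_le:
  assumes "dominated \<epsilon> M N" "prob_space M" "prob_space N"
  shows "measure M A \<le> exp \<epsilon> * measure N A"
proof -
  interpret M: prob_space M by fact
  interpret N: prob_space N by fact
  have "emeasure M A \<le> ennreal (exp \<epsilon>) * emeasure N A"
    using assms(1) by (simp add: dominated_def)
  then show ?thesis
    by (simp add: M.emeasure_eq_measure N.emeasure_eq_measure ennreal_mult[symmetric])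
qed


section \<open>Privacy of the run\<close>

context
  fixes \<beta> \<epsilon> v u :: real
  assumes params: "0 < \<beta>" "\<beta> < 1" "\<epsilon> > 0" "u > 0"
begin

lemma noise_in_prob_algebra:
  assumes "finite S" "S \<noteq> {}" "\<tau> \<ge> 1"
  shows "noise \<beta> \<epsilon> v u S \<tau> \<in> space (prob_algebra (noise \<beta> \<epsilon> v u S \<tau>))"
  unfolding space_prob_algebra noise_def
  using assms by (auto intro!: prob_space_PiM prob_space_Lap noise_scale_pos params)

lemma measurable_run_survivors:
  assumes "finite S" "S \<noteq> {}" "\<tau> \<ge> 1"
  shows "(\<lambda>\<eta>. run \<beta> \<epsilon> v u (survivors \<beta> \<epsilon> v u S \<tau> h \<eta>) (\<tau> + 1) [] xs)
    \<in> noise \<beta> \<epsilon> v u S \<tau> \<rightarrow>\<^sub>M prob_algebra (count_space UNIV)"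
proof -
  \<comment> \<open>Survivors form a nonempty set, and \<open>run\<close> is known to be a
    probability measure only for such viable sets. On this discrete space measurability in the
    viable set is automatic.\<close>
  let ?P = "Pow S - {{}}"
  have "survivors \<beta> \<epsilon> v u S \<tau> h \<in> noise \<beta> \<epsilon> v u S \<tau> \<rightarrow>\<^sub>M count_space ?P"
    using measurable_survivors[OF assms(1)] survivors_nonempty[OF assms(1,2)]
      survivors_subset assms(1)
    by (fastforce simp: measurable_count_space_eq2)
  moreover have "(\<lambda>S'. run \<beta> \<epsilon> v u S' (\<tau> + 1) [] xs) \<in> count_space ?P \<rightarrow>\<^sub>M prob_algebra (count_space UNIV)"
    using assms by (auto intro!: run_in_prob_algebra params intro: finite_subset)
  ultimately show ?thesis
    by (rule measurable_compose)
qed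

lemma sets_run:
  assumes "finite S" "S \<noteq> {}" "\<tau> \<ge> 1"
  shows "sets (run \<beta> \<epsilon> v u S \<tau> h xs) = UNIV"
  using run_in_prob_algebra[OF params assms, of v h xs] by (simp add: space_prob_algebra)

lemma sets_epoch_end:
  assumes "finite S" "S \<noteq> {}" "\<tau> \<ge> 1"
  shows "sets (noise \<beta> \<epsilon> v u S \<tau> \<bind>
    (\<lambda>\<eta>. run \<beta> \<epsilon> v u (survivors \<beta> \<epsilon> v u S \<tau> h \<eta>) (\<tau> + 1) [] xs)) = UNIV"
  using sets_bind'[OF noise_in_prob_algebra measurable_run_survivors] assms by simp

lemma emeasure_epoch_end:
  assumes "finite S" "S \<noteq> {}" "\<tau> \<ge> 1"
  shows "emeasure (noise \<beta> \<epsilon> v u S \<tau> \<bind>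
      (\<lambda>\<eta>. run \<beta> \<epsilon> v u (survivors \<beta> \<epsilon> v u S \<tau> h \<eta>) (\<tau> + 1) [] xs)) A =
    (\<integral>\<^sup>+\<eta>. emeasure (run \<beta> \<epsilon> v u (survivors \<beta> \<epsilon> v u S \<tau> h \<eta>) (\<tau> + 1) [] xs) A \<partial>noise \<beta> \<epsilon> v u S \<tau>)"
  using emeasure_bind_prob_algebra[OF noise_in_prob_algebra measurable_run_survivors] assms by simp

lemma measurable_emeasure_run_survivors:
  assumes "finite S" "S \<noteq> {}" "\<tau> \<ge> 1"
  shows "(\<lambda>\<eta>. emeasure (run \<beta> \<epsilon> v u (survivors \<beta> \<epsilon> v u S \<tau> h \<eta>) (\<tau> + 1) [] xs) A)
    \<in> borel_measurable (noise \<beta> \<epsilon> v u S \<tau>)"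
  using measurable_compose[OF measurable_prob_algebraD[OF measurable_run_survivors[OF assms]]
      measurable_emeasure_subprob_algebra[of A "count_space UNIV"]] by simp

text \<open>This is where the privacy budget is spent: the changed reward becomes a shift of one
  Laplace coordinate, and the continuation depends on the history only through the
  survivors.\<close>

lemma dominated_epoch_end_history:
  assumes S: "finite S" "S \<noteq> {}" "\<tau> \<ge> 1" and "a \<in> S"
  shows "dominated \<epsilon>
    (noise \<beta> \<epsilon> v u S \<tau> \<bind>
      (\<lambda>\<eta>. run \<beta> \<epsilon> v u (survivors \<beta> \<epsilon> v u S \<tau> (h1 @ (a, x) # h2) \<eta>) (\<tau> + 1) [] xs))
    (noise \<beta> \<epsilon> v u S \<tau> \<bind>
      (\<lambda>\<eta>. run \<beta> \<epsilon> v u (survivors \<beta> \<epsilon> v u S \<tau> (h1 @ (a, y) # h2) \<eta>) (\<tau> + 1) [] xs))"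
proof -
  define b where "b = 2 * epoch_B \<beta> \<epsilon> v u S \<tau> / (real (epoch_R \<beta> \<epsilon> v u S \<tau>) * \<epsilon>)"
  have b: "b > 0"
    unfolding b_def by (rule noise_scale_pos[OF params S])
  have noise: "noise \<beta> \<epsilon> v u S \<tau> = (\<Pi>\<^sub>M i\<in>S. Lap b)"
    by (simp add: noise_def b_def)
  define \<delta> where "\<delta> = truncated_mean \<beta> \<epsilon> v u S \<tau> (h1 @ (a, y) # h2) a
    - truncated_mean \<beta> \<epsilon> v u S \<tau> (h1 @ (a, x) # h2) a"
  \<comment> \<open>The noise scale is calibrated so that \<epsilon> b = 2 B / R, which is the
    sensitivity bound.\<close>
  have "\<bar>\<delta>\<bar> \<le> \<epsilon> * b"
    using truncated_mean_sensitivity params by (simp add: \<delta>_def b_def)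
  then have "exp (\<bar>\<delta>\<bar> / b) \<le> exp \<epsilon>"
    using b by (simp add: divide_le_eq)
  then have le: "ennreal (exp (\<bar>\<delta>\<bar> / b)) * m \<le> ennreal (exp \<epsilon>) * m" for m
    by (intro mult_right_mono ennreal_leI) auto
  show ?thesis
    unfolding dominated_def emeasure_epoch_end[OF S]
    \<comment> \<open>Both integrals now involve the same history, with the noise of
      \<open>a\<close> shifted on the right only.\<close>
    unfolding survivors_replace[OF \<delta>_def]
  proof
    fix A
    show "(\<integral>\<^sup>+\<eta>. emeasure (run \<beta> \<epsilon> v u (survivors \<beta> \<epsilon> v u S \<tau> (h1 @ (a, x) # h2) \<eta>) (\<tau> + 1) [] xs) A
        \<partial>noise \<beta> \<epsilon> v u S \<tau>) \<le> ennreal (exp \<epsilon>) *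
      (\<integral>\<^sup>+\<eta>. emeasure (run \<beta> \<epsilon> v u (survivors \<beta> \<epsilon> v u S \<tau> (h1 @ (a, x) # h2) (\<eta>(a := \<eta> a + \<delta>)))
        (\<tau> + 1) [] xs) A \<partial>noise \<beta> \<epsilon> v u S \<tau>)"
      using nn_integral_PiM_Lap_shift_le[OF b S(1) assms(4)
        measurable_emeasure_run_survivors[OF S, unfolded noise], of "h1 @ (a, x) # h2" xs A \<delta>]
        le order_trans unfolding noise by blast
  qed
qed

text \<open>Histories of equal length lead to the same arm and the same branch; the three domination
  hypotheses match the three branches. Rewards, tails and histories may all differ, so the rule
  serves both inductions below.\<close>

lemma dominated_run_Cons:
  assumes S: "finite S" "S \<noteq> {}" "\<tau> \<ge> 1" and len: "length h = length h'"
    and single: "dominated \<epsilon> (run \<beta> \<epsilon> v u S \<tau> h xs) (run \<beta> \<epsilon> v u S \<tau> h' ys)"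
    and same_epoch: "dominated \<epsilon> (run \<beta> \<epsilon> v u S \<tau> (h @ [(next_arm S h, x)]) xs)
      (run \<beta> \<epsilon> v u S \<tau> (h' @ [(next_arm S h, y)]) ys)"
    and epoch_end: "dominated \<epsilon>
      (noise \<beta> \<epsilon> v u S \<tau> \<bind> (\<lambda>\<eta>. run \<beta> \<epsilon> v u
        (survivors \<beta> \<epsilon> v u S \<tau> (h @ [(next_arm S h, x)]) \<eta>) (\<tau> + 1) [] xs))
      (noise \<beta> \<epsilon> v u S \<tau> \<bind> (\<lambda>\<eta>. run \<beta> \<epsilon> v u
        (survivors \<beta> \<epsilon> v u S \<tau> (h' @ [(next_arm S h, y)]) \<eta>) (\<tau> + 1) [] ys))"
  shows "dominated \<epsilon> (run \<beta> \<epsilon> v u S \<tau> h (x # xs)) (run \<beta> \<epsilon> v u S \<tau> h' (y # ys))"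
proof -
  have arm: "next_arm S h' = next_arm S h"
    and len': "length (h' @ [(next_arm S h, y)]) = length (h @ [(next_arm S h, x)])"
    using len by (simp_all add: next_arm_def)
  show ?thesis
    unfolding run.simps Let_def arm len' using single same_epoch epoch_end
    by (cases "card S = 1"; cases "length (h @ [(next_arm S h, x)]) < card S * epoch_R \<beta> \<epsilon> v u S \<tau>";
        simp only: if_True if_False simp_thms; intro dominated_distr sets_run[OF S] sets_epoch_end[OF S])
qed

text \<open>The factor is paid at most once: the changed pair stays in the history until the epoch
  ends, and the next epoch starts from \<open>[]\<close>. If the horizon comes first, or a single
  arm is left, it has no effect. Later pairs pile up behind it, so \<open>h2\<close> is
  generalised.\<close>

lemma dominated_run_history:
  assumes S: "finite S" "S \<noteq> {}" "\<tau> \<ge> 1" and "a \<in> S"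
  shows "dominated \<epsilon> (run \<beta> \<epsilon> v u S \<tau> (h1 @ (a, x) # h2) xs)
    (run \<beta> \<epsilon> v u S \<tau> (h1 @ (a, y) # h2) xs)"
proof (induction xs arbitrary: h2)
  case Nil
  then show ?case
    using params by (simp add: dominated_refl)
next
  case (Cons z xs)
  let ?h2 = "h2 @ [(next_arm S (h1 @ (a, x) # h2), z)]"
  show ?case
    using Cons.IH[of h2] Cons.IH[of ?h2] dominated_epoch_end_history[OF assms, of h1 x ?h2 xs y]
    by (intro dominated_run_Cons[OF S]) (simp_all only: append_assoc append_Cons length_append list.size)
qed

text \<open>With equal histories the same noise gives the same survivors, so the bound on the
  continuations is merely averaged over the noise and costs no extra factor.\<close>

lemma dominated_epoch_end_stream:
  assumes S: "finite S" "S \<noteq> {}" "\<tau> \<ge> 1"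
    and "\<And>S'. finite S' \<Longrightarrow> S' \<noteq> {} \<Longrightarrow>
      dominated \<epsilon> (run \<beta> \<epsilon> v u S' (\<tau> + 1) [] xs) (run \<beta> \<epsilon> v u S' (\<tau> + 1) [] ys)"
  shows "dominated \<epsilon>
    (noise \<beta> \<epsilon> v u S \<tau> \<bind> (\<lambda>\<eta>. run \<beta> \<epsilon> v u (survivors \<beta> \<epsilon> v u S \<tau> h \<eta>) (\<tau> + 1) [] xs))
    (noise \<beta> \<epsilon> v u S \<tau> \<bind> (\<lambda>\<eta>. run \<beta> \<epsilon> v u (survivors \<beta> \<epsilon> v u S \<tau> h \<eta>) (\<tau> + 1) [] ys))"
proof -
  have "dominated \<epsilon> (run \<beta> \<epsilon> v u (survivors \<beta> \<epsilon> v u S \<tau> h \<eta>) (\<tau> + 1) [] xs)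
      (run \<beta> \<epsilon> v u (survivors \<beta> \<epsilon> v u S \<tau> h \<eta>) (\<tau> + 1) [] ys)" for \<eta>
    using finite_subset[OF survivors_subset S(1)] survivors_nonempty[OF S(1,2)] by (intro assms(4))
  then have "(\<integral>\<^sup>+\<eta>. emeasure (run \<beta> \<epsilon> v u (survivors \<beta> \<epsilon> v u S \<tau> h \<eta>) (\<tau> + 1) [] xs) A
      \<partial>noise \<beta> \<epsilon> v u S \<tau>) \<le> (\<integral>\<^sup>+\<eta>. ennreal (exp \<epsilon>) *
      emeasure (run \<beta> \<epsilon> v u (survivors \<beta> \<epsilon> v u S \<tau> h \<eta>) (\<tau> + 1) [] ys) A \<partial>noise \<beta> \<epsilon> v u S \<tau>)" for A
    unfolding dominated_def by (intro nn_integral_mono) blast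
  then show ?thesis
    unfolding dominated_def emeasure_epoch_end[OF S]
      nn_integral_cmult[OF measurable_emeasure_run_survivors[OF S]]
    by blast
qed

text \<open>Induction on the common prefix, during which viable set, epoch and history
  evolve.\<close>

lemma dominated_run_stream:
  assumes "finite S" "S \<noteq> {}" "\<tau> \<ge> 1"
  shows "dominated \<epsilon> (run \<beta> \<epsilon> v u S \<tau> h (xs @ x # zs)) (run \<beta> \<epsilon> v u S \<tau> h (xs @ y # zs))"
  using assms
proof (induction xs arbitrary: S \<tau> h)
  case Nil
  let ?a = "next_arm S h"
  have a: "?a \<in> S"
    using Nil by (intro next_arm_in)
  show ?case
    \<comment> \<open>The round where the rewards differ. With one arm left the reward is discarded
      and the runs coincide; otherwise it enters the history, and the history lemmas apply with
      \<open>h2 = []\<close>.\<close>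
    unfolding append_Nil using params
    by (intro dominated_run_Cons[OF Nil] dominated_run_history[OF Nil a]
        dominated_epoch_end_history[OF Nil a] refl dominated_refl less_imp_le)
next
  case (Cons z xs)
  show ?case
    unfolding append_Cons
    using Cons.prems by (intro dominated_run_Cons dominated_epoch_end_stream Cons.IH) simp_all
qed

end

text \<open>Cutting both streams at the index where they differ gives the form suited to induction
  on the prefix.\<close>

lemma adjacent_split:
  assumes "adjacent \<sigma> \<sigma>'"
  obtains xs x y zs where "\<sigma> = xs @ x # zs" "\<sigma>' = xs @ y # zs"
proof -
  obtain t where t: "t < length \<sigma>" and uniq: "\<And>s. s < length \<sigma> \<Longrightarrow> s \<noteq> t \<Longrightarrow> \<sigma> ! s = \<sigma>' ! s"
    and len: "length \<sigma> = length \<sigma>'"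
    using assms unfolding adjacent_def by blast
  have "take t \<sigma> = take t \<sigma>'" "drop (Suc t) \<sigma> = drop (Suc t) \<sigma>'"
    using t uniq len by (auto intro!: nth_equalityI)
  then have "\<sigma> = take t \<sigma> @ \<sigma> ! t # drop (Suc t) \<sigma>" "\<sigma>' = take t \<sigma> @ \<sigma>' ! t # drop (Suc t) \<sigma>"
    using id_take_nth_drop[of t \<sigma>] id_take_nth_drop[of t \<sigma>'] t len by simp_all
  then show thesis
    by (rule that)
qed

theorem theorem3:
  fixes K T :: nat and v u \<beta> \<epsilon> :: real
  assumes "K \<ge> 2" and "T \<ge> 1" and "0 < v" and "v \<le> 1" and "u > 0"
    and "0 < \<beta>" and "\<beta> < 1" and "\<epsilon> > 0"
  shows "differentially_private T \<epsilon> (dp_rse \<beta> \<epsilon> v u K)"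
  unfolding differentially_private_def
proof (intro allI impI ballI, elim conjE)
  fix \<sigma> \<sigma>' A
  assume "adjacent \<sigma> \<sigma>'"
  then obtain xs x y zs where "\<sigma> = xs @ x # zs" "\<sigma>' = xs @ y # zs"
    by (rule adjacent_split)
  then have "dominated \<epsilon> (dp_rse \<beta> \<epsilon> v u K \<sigma>) (dp_rse \<beta> \<epsilon> v u K \<sigma>')"
    unfolding dp_rse_def using assms by (auto intro!: dominated_run_stream)
  then show "measure (dp_rse \<beta> \<epsilon> v u K \<sigma>) A \<le> exp \<epsilon> * measure (dp_rse \<beta> \<epsilon> v u K \<sigma>') A"
    using assms by (intro dominated_imp_measure_le prob_space_dp_rse) auto
qed

end
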